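(* Let $\mathcal{X},\mathcal{Y},\mathcal{Z}$ be length abelian categories and let $R(\mathcal{Y},\mathcal{X},\mathcal{Z})$ be a recollement of $\mathcal{X}$ relative to $\mathcal{Y}$ and $\mathcal{Z}$, with functors $i^{*},i^{!}:\mathcal{X}\to\mathcal{Y}$, $i_{*}:\mathcal{Y}\to\mathcal{X}$, $j^{*}:\mathcal{X}\to\mathcal{Z}$, $j_{!},j_{*}:\mathcal{Z}\to\mathcal{X}$. Let $\mathcal{F}_{\mathcal{Y}}$ and $\mathcal{F}_{\mathcal{Z}}$ be subcategories of $\mathcal{Y}$ and $\mathcal{Z}$ respectively, and let $$\mathcal{F}_{\mathcal{X}}=\{X\in\mathcal{X}\mid j^{*}X\in\mathcal{F}_{\mathcal{Z}},\ i^{!}X\in\mathcal{F}_{\mathcal{Y}}\}.$$ Then the following are equivalent: (1) $\mathcal{F}_{\mathcal{Y}}$ and $\mathcal{F}_{\mathcal{Z}}$ are torsion-free classes (in $\mathcal{Y}$ and $\mathcal{Z}$ respectively). (2) $\mathcal{F}_{\mathcal{X}}$ is a torsion-free class in $\mathcal{X}$.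
   Context: A length abelian category is an abelian category in which every object has finite length. "Subcategory" means a full subcategory closed under isomorphisms and containing the zero object. The functor $i^{!}$ is not assumed to be exact. Recollement: for abelian categories $\mathcal{X},\mathcal{Y},\mathcal{Z}$, a recollement of $\mathcal{X}$ relative to $\mathcal{Y}$ and $\mathcal{Z}$ consists of functors $i^{*},i^{!}:\mathcal{X}\to\mathcal{Y}$, $i_{*}:\mathcal{Y}\to\mathcal{X}$, $j^{*}:\mathcal{X}\to\mathcal{Z}$, $j_{!},j_{*}:\mathcal{Z}\to\mathcal{X}$ such that: (a) $(i^{*},i_{*})$, $(i_{*},i^{!})$, $(j_{!},j^{*})$, $(j^{*},j_{*})$ are adjoint pairs (left adjoint written first); (b) $i_{*},j_{!},j_{*}$ are fully faithful; (c) $\operatorname{Im} i_{*}=\operatorname{Ker} j^{*}$ (the essential image of $i_*$ is the full subcategory of objects $X$ with $j^{*}X=0$). A subcategory of a length abelian category $\mathcal{A}$ is a torsion-free class in $\mathcal{A}$ if it is closed under extensions and subobjects in $\mathcal{A}$. *)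

theory Defs
  imports "HOL-Algebra.Group"
begin

section \<open>Categories and functors\<close>

record ('o, 'm) category =
  Obj :: "'o set"
  Arr :: "'m set"
  Dom :: "'m \<Rightarrow> 'o"
  Cod :: "'m \<Rightarrow> 'o"
  Ident :: "'o \<Rightarrow> 'm"
  Comp :: "'m \<Rightarrow> 'm \<Rightarrow> 'm"  (infixr \<open>\<cdot>\<index>\<close> 70)

definition homset :: "('o, 'm, 'e) category_scheme \<Rightarrow> 'o \<Rightarrow> 'o \<Rightarrow> 'm set" where
  "homset C A B = {f \<in> Arr C. Dom C f = A \<and> Cod C f = B}"

text \<open>The value of \<open>g \<cdot> f\<close> (first \<open>f\<close>, then \<open>g\<close>) is meaningful only if
  the codomain of \<open>f\<close> is the domain of \<open>g\<close>.\<close>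

locale category =
  fixes C (structure)
  assumes Dom_in_Obj: "f \<in> Arr C \<Longrightarrow> Dom C f \<in> Obj C"
    and Cod_in_Obj: "f \<in> Arr C \<Longrightarrow> Cod C f \<in> Obj C"
    and Ident_in_homset: "A \<in> Obj C \<Longrightarrow> Ident C A \<in> homset C A A"
    and Comp_in_homset:
      "\<lbrakk>f \<in> homset C A B; g \<in> homset C B D\<rbrakk> \<Longrightarrow> g \<cdot> f \<in> homset C A D"
    and Comp_Ident: "f \<in> homset C A B \<Longrightarrow> f \<cdot> Ident C A = f"
    and Ident_Comp: "f \<in> homset C A B \<Longrightarrow> Ident C B \<cdot> f = f"
    and Comp_assoc:
      "\<lbrakk>f \<in> homset C A B; g \<in> homset C B D; h \<in> homset C D E\<rbrakk>
        \<Longrightarrow> (h \<cdot> g) \<cdot> f = h \<cdot> (g \<cdot> f)"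

definition is_mono :: "('o, 'm, 'e) category_scheme \<Rightarrow> 'm \<Rightarrow> bool" where
  "is_mono C f \<longleftrightarrow> f \<in> Arr C \<and>
    (\<forall>A. \<forall>g \<in> homset C A (Dom C f). \<forall>h \<in> homset C A (Dom C f).
      f \<cdot>\<^bsub>C\<^esub> g = f \<cdot>\<^bsub>C\<^esub> h \<longrightarrow> g = h)"

definition is_epi :: "('o, 'm, 'e) category_scheme \<Rightarrow> 'm \<Rightarrow> bool" where
  "is_epi C f \<longleftrightarrow> f \<in> Arr C \<and>
    (\<forall>B. \<forall>g \<in> homset C (Cod C f) B. \<forall>h \<in> homset C (Cod C f) B.
      g \<cdot>\<^bsub>C\<^esub> f = h \<cdot>\<^bsub>C\<^esub> f \<longrightarrow> g = h)"

definition is_iso :: "('o, 'm, 'e) category_scheme \<Rightarrow> 'm \<Rightarrow> bool" where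
  "is_iso C f \<longleftrightarrow> f \<in> Arr C \<and>
    (\<exists>g \<in> homset C (Cod C f) (Dom C f).
      g \<cdot>\<^bsub>C\<^esub> f = Ident C (Dom C f) \<and> f \<cdot>\<^bsub>C\<^esub> g = Ident C (Cod C f))"

definition isomorphic :: "('o, 'm, 'e) category_scheme \<Rightarrow> 'o \<Rightarrow> 'o \<Rightarrow> bool" where
  "isomorphic C A B \<longleftrightarrow> (\<exists>f \<in> homset C A B. is_iso C f)"

definition is_zero_obj :: "('o, 'm, 'e) category_scheme \<Rightarrow> 'o \<Rightarrow> bool" where
  "is_zero_obj C N \<longleftrightarrow> N \<in> Obj C \<and>
    (\<forall>A \<in> Obj C. (\<exists>!f. f \<in> homset C A N) \<and> (\<exists>!f. f \<in> homset C N A))"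

record ('o, 'm, 'p, 'n) cfunctor =
  OMap :: "'o \<Rightarrow> 'p"
  AMap :: "'m \<Rightarrow> 'n"

locale cfunctor =
  source: category C + target: category D
  for C :: "('o, 'm, 'e) category_scheme"
    and D :: "('p, 'n, 'd) category_scheme"
    and F :: "('o, 'm, 'p, 'n) cfunctor" +
  assumes OMap_in_Obj: "A \<in> Obj C \<Longrightarrow> OMap F A \<in> Obj D"
    and AMap_in_homset:
      "f \<in> homset C A B \<Longrightarrow> AMap F f \<in> homset D (OMap F A) (OMap F B)"
    and AMap_Ident: "A \<in> Obj C \<Longrightarrow> AMap F (Ident C A) = Ident D (OMap F A)"
    and AMap_Comp:
      "\<lbrakk>f \<in> homset C A B; g \<in> homset C B E\<rbrakk>
        \<Longrightarrow> AMap F (g \<cdot>\<^bsub>C\<^esub> f) = AMap F g \<cdot>\<^bsub>D\<^esub> AMap F f"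

definition fully_faithful ::
  "('o, 'm, 'e) category_scheme \<Rightarrow> ('p, 'n, 'd) category_scheme
    \<Rightarrow> ('o, 'm, 'p, 'n) cfunctor \<Rightarrow> bool" where
  "fully_faithful C D F \<longleftrightarrow>
    (\<forall>A \<in> Obj C. \<forall>B \<in> Obj C.
      bij_betw (AMap F) (homset C A B) (homset D (OMap F A) (OMap F B)))"

definition essential_image ::
  "('o, 'm, 'e) category_scheme \<Rightarrow> ('p, 'n, 'd) category_scheme
    \<Rightarrow> ('o, 'm, 'p, 'n) cfunctor \<Rightarrow> 'p set" where
  "essential_image C D F = {B \<in> Obj D. \<exists>A \<in> Obj C. isomorphic D (OMap F A) B}"

definition functor_kernel ::
  "('o, 'm, 'e) category_scheme \<Rightarrow> ('p, 'n, 'd) category_scheme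
    \<Rightarrow> ('o, 'm, 'p, 'n) cfunctor \<Rightarrow> 'o set" where
  "functor_kernel C D F = {A \<in> Obj C. is_zero_obj D (OMap F A)}"

text \<open>In \<open>adjoint_pair C D L R\<close> the functor \<open>L\<close> from \<open>C\<close> to \<open>D\<close> is the left adjoint:
  there is a bijection between arrows \<open>L A \<rightarrow> B\<close> in \<open>D\<close> and arrows \<open>A \<rightarrow> R B\<close> in \<open>C\<close>,
  natural in \<open>A\<close> and \<open>B\<close>.\<close>

definition adjoint_pair ::
  "('o, 'm, 'e) category_scheme \<Rightarrow> ('p, 'n, 'd) category_scheme
    \<Rightarrow> ('o, 'm, 'p, 'n) cfunctor \<Rightarrow> ('p, 'n, 'o, 'm) cfunctor \<Rightarrow> bool" where
  "adjoint_pair C D L R \<longleftrightarrow>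
    (\<exists>\<phi> :: 'o \<Rightarrow> 'p \<Rightarrow> 'n \<Rightarrow> 'm.
      (\<forall>A \<in> Obj C. \<forall>B \<in> Obj D.
        bij_betw (\<phi> A B) (homset D (OMap L A) B) (homset C A (OMap R B))) \<and>
      (\<forall>A \<in> Obj C. \<forall>A' \<in> Obj C. \<forall>B \<in> Obj D. \<forall>B' \<in> Obj D.
        \<forall>f \<in> homset C A' A. \<forall>g \<in> homset D B B'. \<forall>h \<in> homset D (OMap L A) B.
          \<phi> A' B' (g \<cdot>\<^bsub>D\<^esub> (h \<cdot>\<^bsub>D\<^esub> AMap L f))
            = AMap R g \<cdot>\<^bsub>C\<^esub> (\<phi> A B h \<cdot>\<^bsub>C\<^esub> f)))"


section \<open>Length abelian categories\<close>

text \<open>\<open>Plus\<close> is meaningful on parallel arrows only; \<open>Zero C A B\<close> is the zero arrow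
  from \<open>A\<close> to \<open>B\<close>.\<close>

record ('o, 'm) preadditive_category = "('o, 'm) category" +
  Plus :: "'m \<Rightarrow> 'm \<Rightarrow> 'm"
  Zero :: "'o \<Rightarrow> 'o \<Rightarrow> 'm"

definition hom_group ::
  "('o, 'm, 'e) preadditive_category_scheme \<Rightarrow> 'o \<Rightarrow> 'o \<Rightarrow> 'm monoid" where
  "hom_group C A B = \<lparr>carrier = homset C A B, mult = Plus C, one = Zero C A B\<rparr>"

locale preadditive_category = category C
  for C :: "('o, 'm, 'e) preadditive_category_scheme" (structure) +
  assumes comm_group_hom_group:
      "\<lbrakk>A \<in> Obj C; B \<in> Obj C\<rbrakk> \<Longrightarrow> comm_group (hom_group C A B)"
    and Comp_Plus_left:
      "\<lbrakk>f \<in> homset C A B; g \<in> homset C B D; h \<in> homset C B D\<rbrakk>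
        \<Longrightarrow> Plus C g h \<cdot> f = Plus C (g \<cdot> f) (h \<cdot> f)"
    and Comp_Plus_right:
      "\<lbrakk>f \<in> homset C A B; g \<in> homset C A B; h \<in> homset C B D\<rbrakk>
        \<Longrightarrow> h \<cdot> Plus C f g = Plus C (h \<cdot> f) (h \<cdot> g)"

definition is_biproduct ::
  "('o, 'm, 'e) preadditive_category_scheme
    \<Rightarrow> 'o \<Rightarrow> 'o \<Rightarrow> 'o \<Rightarrow> 'm \<Rightarrow> 'm \<Rightarrow> 'm \<Rightarrow> 'm \<Rightarrow> bool" where
  "is_biproduct C A B P i1 i2 p1 p2 \<longleftrightarrow>
    P \<in> Obj C \<and>
    i1 \<in> homset C A P \<and> i2 \<in> homset C B P \<and> p1 \<in> homset C P A \<and> p2 \<in> homset C P B \<and>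
    p1 \<cdot>\<^bsub>C\<^esub> i1 = Ident C A \<and> p2 \<cdot>\<^bsub>C\<^esub> i2 = Ident C B \<and>
    p2 \<cdot>\<^bsub>C\<^esub> i1 = Zero C A B \<and> p1 \<cdot>\<^bsub>C\<^esub> i2 = Zero C B A \<and>
    Plus C (i1 \<cdot>\<^bsub>C\<^esub> p1) (i2 \<cdot>\<^bsub>C\<^esub> p2) = Ident C P"

definition is_kernel :: "('o, 'm, 'e) preadditive_category_scheme \<Rightarrow> 'm \<Rightarrow> 'm \<Rightarrow> bool" where
  "is_kernel C k g \<longleftrightarrow>
    k \<in> Arr C \<and> g \<in> Arr C \<and> Cod C k = Dom C g \<and>
    g \<cdot>\<^bsub>C\<^esub> k = Zero C (Dom C k) (Cod C g) \<and>
    (\<forall>A \<in> Obj C. \<forall>h \<in> homset C A (Dom C g). g \<cdot>\<^bsub>C\<^esub> h = Zero C A (Cod C g) \<longrightarrow>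
      (\<exists>!u. u \<in> homset C A (Dom C k) \<and> k \<cdot>\<^bsub>C\<^esub> u = h))"

definition is_cokernel :: "('o, 'm, 'e) preadditive_category_scheme \<Rightarrow> 'm \<Rightarrow> 'm \<Rightarrow> bool" where
  "is_cokernel C q f \<longleftrightarrow>
    q \<in> Arr C \<and> f \<in> Arr C \<and> Dom C q = Cod C f \<and>
    q \<cdot>\<^bsub>C\<^esub> f = Zero C (Dom C f) (Cod C q) \<and>
    (\<forall>B \<in> Obj C. \<forall>h \<in> homset C (Cod C f) B. h \<cdot>\<^bsub>C\<^esub> f = Zero C (Dom C f) B \<longrightarrow>
      (\<exists>!u. u \<in> homset C (Cod C q) B \<and> u \<cdot>\<^bsub>C\<^esub> q = h))"

locale abelian_category = preadditive_category C
  for C :: "('o, 'm, 'e) preadditive_category_scheme" (structure) +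
  assumes zero_obj_exists: "\<exists>N. is_zero_obj C N"
    and biproduct_exists:
      "\<lbrakk>A \<in> Obj C; B \<in> Obj C\<rbrakk> \<Longrightarrow> \<exists>P i1 i2 p1 p2. is_biproduct C A B P i1 i2 p1 p2"
    and kernel_exists: "f \<in> Arr C \<Longrightarrow> \<exists>k. is_kernel C k f"
    and cokernel_exists: "f \<in> Arr C \<Longrightarrow> \<exists>q. is_cokernel C q f"
    and mono_is_kernel: "is_mono C f \<Longrightarrow> \<exists>g. is_kernel C f g"
    and epi_is_cokernel: "is_epi C f \<Longrightarrow> \<exists>g. is_cokernel C f g"

definition short_exact :: "('o, 'm, 'e) preadditive_category_scheme \<Rightarrow> 'm \<Rightarrow> 'm \<Rightarrow> bool" where
  "short_exact C f g \<longleftrightarrow> is_kernel C f g \<and> is_cokernel C g f"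

definition is_simple :: "('o, 'm, 'e) category_scheme \<Rightarrow> 'o \<Rightarrow> bool" where
  "is_simple C S \<longleftrightarrow> S \<in> Obj C \<and> \<not> is_zero_obj C S \<and>
    (\<forall>f. is_mono C f \<and> Cod C f = S \<longrightarrow> is_zero_obj C (Dom C f) \<or> is_iso C f)"

text \<open>An object has finite length if it has a composition series
  \<open>0 = U 0 \<subseteq> U 1 \<subseteq> \<dots> \<subseteq> U n = A\<close>: the inclusions are the arrows \<open>m k\<close>, and the
  quotients \<open>U (k + 1) / U k\<close> are the simple codomains of the arrows \<open>q k\<close>.\<close>

definition has_finite_length ::
  "('o, 'm, 'e) preadditive_category_scheme \<Rightarrow> 'o \<Rightarrow> bool" where
  "has_finite_length C A \<longleftrightarrow>
    (\<exists>(n::nat) (U :: nat \<Rightarrow> 'o) (m :: nat \<Rightarrow> 'm) (q :: nat \<Rightarrow> 'm).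
      is_zero_obj C (U 0) \<and> U n = A \<and>
      (\<forall>k<n. m k \<in> homset C (U k) (U (Suc k)) \<and> short_exact C (m k) (q k) \<and>
        is_simple C (Cod C (q k))))"

locale length_abelian_category = abelian_category C
  for C :: "('o, 'm, 'e) preadditive_category_scheme" (structure) +
  assumes finite_length: "A \<in> Obj C \<Longrightarrow> has_finite_length C A"


section \<open>Torsion-free classes and recollements\<close>

text \<open>Full subcategories are given by their sets of objects.\<close>

definition subcategory :: "('o, 'm, 'e) category_scheme \<Rightarrow> 'o set \<Rightarrow> bool" where
  "subcategory C S \<longleftrightarrow> S \<subseteq> Obj C \<and>
    (\<forall>A \<in> S. \<forall>B \<in> Obj C. isomorphic C A B \<longrightarrow> B \<in> S) \<and>
    (\<exists>N \<in> S. is_zero_obj C N)"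

definition closed_under_subobjects :: "('o, 'm, 'e) category_scheme \<Rightarrow> 'o set \<Rightarrow> bool" where
  "closed_under_subobjects C S \<longleftrightarrow>
    (\<forall>f. is_mono C f \<and> Cod C f \<in> S \<longrightarrow> Dom C f \<in> S)"

definition closed_under_extensions ::
  "('o, 'm, 'e) preadditive_category_scheme \<Rightarrow> 'o set \<Rightarrow> bool" where
  "closed_under_extensions C S \<longleftrightarrow>
    (\<forall>f g. short_exact C f g \<and> Dom C f \<in> S \<and> Cod C g \<in> S \<longrightarrow> Cod C f \<in> S)"

definition torsion_free_class ::
  "('o, 'm, 'e) preadditive_category_scheme \<Rightarrow> 'o set \<Rightarrow> bool" where
  "torsion_free_class C S \<longleftrightarrow>
    subcategory C S \<and> closed_under_extensions C S \<and> closed_under_subobjects C S"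

text \<open>The functors are named after the usual symbols: \<open>iu_star\<close> is \<open>i\<close> with upper star,
  \<open>il_star\<close> is \<open>i\<close> with lower star, \<open>iu_shriek\<close> is \<open>i\<close> with upper shriek, and similarly
  for \<open>j\<close>. They are not required to be additive: this follows from the adjunctions.\<close>

locale recollement =
  Y: abelian_category Y + X: abelian_category X + Z: abelian_category Z +
  iu_star: cfunctor X Y iu_star + il_star: cfunctor Y X il_star +
  iu_shriek: cfunctor X Y iu_shriek +
  jl_shriek: cfunctor Z X jl_shriek + ju_star: cfunctor X Z ju_star +
  jl_star: cfunctor Z X jl_star
  for Y :: "('yo, 'ym, 'ye) preadditive_category_scheme"
    and X :: "('xo, 'xm, 'xe) preadditive_category_scheme"
    and Z :: "('zo, 'zm, 'ze) preadditive_category_scheme"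
    and iu_star :: "('xo, 'xm, 'yo, 'ym) cfunctor"
    and il_star :: "('yo, 'ym, 'xo, 'xm) cfunctor"
    and iu_shriek :: "('xo, 'xm, 'yo, 'ym) cfunctor"
    and jl_shriek :: "('zo, 'zm, 'xo, 'xm) cfunctor"
    and ju_star :: "('xo, 'xm, 'zo, 'zm) cfunctor"
    and jl_star :: "('zo, 'zm, 'xo, 'xm) cfunctor" +
  assumes adjoint_iu_star_il_star: "adjoint_pair X Y iu_star il_star"
    and adjoint_il_star_iu_shriek: "adjoint_pair Y X il_star iu_shriek"
    and adjoint_jl_shriek_ju_star: "adjoint_pair Z X jl_shriek ju_star"
    and adjoint_ju_star_jl_star: "adjoint_pair X Z ju_star jl_star"
    and fully_faithful_il_star: "fully_faithful Y X il_star"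
    and fully_faithful_jl_shriek: "fully_faithful Z X jl_shriek"
    and fully_faithful_jl_star: "fully_faithful Z X jl_star"
    and essential_image_eq_kernel: "essential_image Y X il_star = functor_kernel X Z ju_star"

end

(*
  All four functors i_*, i^!, j^* and j_* are right adjoints, hence preserve kernels. In an
  abelian category a torsion-free class contains B as soon as 0 -> A -> B -> C is exact with A
  and C in the class, because the image of B -> C is a subobject of C. Hence the preimage of a
  torsion-free class under a right adjoint is torsion-free. Now F_X is the intersection of the
  preimages of F_Z under j^* and of F_Y under i^!, and conversely F_Y and F_Z are the preimages
  of F_X under i_* and j_*, since j^* i_* = 0, i^! i_* = 1, i^! j_* = 0 and j^* j_* = 1 up to
  isomorphism.
*)
theory Submission imports Defs begin

section \<open>Categories and functors\<close>

context category
begin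

lemma homsetD:
  assumes "f \<in> homset C A B"
  shows "f \<in> Arr C" "Dom C f = A" "Cod C f = B" "A \<in> Obj C" "B \<in> Obj C"
  using assms Dom_in_Obj Cod_in_Obj by (auto simp: homset_def)

lemma Arr_homset: "f \<in> Arr C \<Longrightarrow> f \<in> homset C (Dom C f) (Cod C f)"
  by (simp add: homset_def)

lemma is_monoD:
  "\<lbrakk>is_mono C m; m \<in> homset C A B; g \<in> homset C T A; h \<in> homset C T A; m \<cdot> g = m \<cdot> h\<rbrakk> \<Longrightarrow> g = h"
  unfolding is_mono_def by (metis homsetD(2))

lemma isomorphicI:
  assumes "f \<in> homset C A B" "g \<in> homset C B A" "g \<cdot> f = Ident C A" "f \<cdot> g = Ident C B"
  shows "isomorphic C A B"
  using assms unfolding isomorphic_def is_iso_def by (metis homsetD(1-3))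

lemma isomorphicE:
  assumes "isomorphic C A B"
  obtains f g where "f \<in> homset C A B" "g \<in> homset C B A"
    "g \<cdot> f = Ident C A" "f \<cdot> g = Ident C B"
  using assms unfolding isomorphic_def is_iso_def by (metis homsetD(2,3))

lemma isomorphic_refl: "A \<in> Obj C \<Longrightarrow> isomorphic C A A"
  by (rule isomorphicI[of "Ident C A" _ _ "Ident C A"])
    (auto simp: Ident_in_homset Comp_Ident[OF Ident_in_homset])

lemma isomorphic_sym: "isomorphic C A B \<Longrightarrow> isomorphic C B A"
  by (elim isomorphicE) (rule isomorphicI)

lemma zero_objD:
  assumes "is_zero_obj C N"
  shows "N \<in> Obj C" "A \<in> Obj C \<Longrightarrow> \<exists>!f. f \<in> homset C A N" "A \<in> Obj C \<Longrightarrow> \<exists>!f. f \<in> homset C N A"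
  using assms by (simp_all add: is_zero_obj_def)

lemma zero_objs_isomorphic:
  assumes M: "is_zero_obj C M" and N: "is_zero_obj C N"
  shows "isomorphic C M N"
proof -
  note Obj = zero_objD(1)[OF M] zero_objD(1)[OF N]
  obtain f where f: "f \<in> homset C M N" using zero_objD(3)[OF M Obj(2)] by blast
  obtain g where g: "g \<in> homset C N M" using zero_objD(3)[OF N Obj(1)] by blast
  have "g \<cdot> f = Ident C M"
    using zero_objD(3)[OF M Obj(1)] Comp_in_homset[OF f g] Ident_in_homset[OF Obj(1)] by blast
  moreover have "f \<cdot> g = Ident C N"
    using zero_objD(3)[OF N Obj(2)] Comp_in_homset[OF g f] Ident_in_homset[OF Obj(2)] by blast
  ultimately show ?thesis using isomorphicI[OF f g] by blast
qed

lemma subcategory_isomorphic: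
  "\<lbrakk>subcategory C S; isomorphic C A B; B \<in> S\<rbrakk> \<Longrightarrow> A \<in> S"
  by (meson isomorphicE isomorphic_sym homsetD(4) subcategory_def)

lemma subcategory_isomorphic_iff:
  "\<lbrakk>subcategory C S; isomorphic C A B\<rbrakk> \<Longrightarrow> A \<in> S \<longleftrightarrow> B \<in> S"
  using subcategory_isomorphic isomorphic_sym by blast

text \<open>A subcategory is only required to contain some zero object; uniqueness of zero objects
  up to isomorphism supplies all the others.\<close>

lemma subcategory_zero_obj: "\<lbrakk>subcategory C S; is_zero_obj C N\<rbrakk> \<Longrightarrow> N \<in> S"
  using subcategory_isomorphic zero_objs_isomorphic unfolding subcategory_def by meson

end

text \<open>Serves to carry uniqueness of an arrow across the hom bijection of an
  adjunction.\<close>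

lemma bij_betw_ex1:
  assumes "bij_betw f A B" "\<exists>!x. x \<in> A"
  shows "\<exists>!y. y \<in> B"
proof -
  obtain a where "A = {a}" using assms(2) by blast
  then have "B = {f a}" using bij_betw_imp_surj_on[OF assms(1)] by simp
  then show ?thesis by simp
qed

section \<open>Full faithfulness and preservation of isomorphic objects\<close>

context cfunctor
begin

lemma fully_faithful_full:
  assumes "fully_faithful C D F" "A \<in> Obj C" "B \<in> Obj C" "g \<in> homset D (OMap F A) (OMap F B)"
  obtains f where "f \<in> homset C A B" "AMap F f = g"
proof -
  have "bij_betw (AMap F) (homset C A B) (homset D (OMap F A) (OMap F B))"
    using assms(1-3) by (simp add: fully_faithful_def)
  then have "g \<in> AMap F ` homset C A B" using assms(4) by (simp add: bij_betw_imp_surj_on)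
  then show ?thesis using that by blast
qed

lemma fully_faithful_faithful:
  assumes "fully_faithful C D F" "f \<in> homset C A B" "g \<in> homset C A B" "AMap F f = AMap F g"
  shows "f = g"
proof -
  have "bij_betw (AMap F) (homset C A B) (homset D (OMap F A) (OMap F B))"
    using assms(1) source.homsetD(4,5)[OF assms(2)] by (simp add: fully_faithful_def)
  then show ?thesis using assms(2-4) by (auto dest: bij_betw_imp_inj_on inj_onD)
qed

lemma isomorphic_OMap:
  assumes "isomorphic C A B"
  shows "isomorphic D (OMap F A) (OMap F B)"
proof -
  obtain f g where f: "f \<in> homset C A B" and g: "g \<in> homset C B A"
    and id: "g \<cdot>\<^bsub>C\<^esub> f = Ident C A" "f \<cdot>\<^bsub>C\<^esub> g = Ident C B"
    using assms by (rule source.isomorphicE)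
  show ?thesis
  proof (rule target.isomorphicI)
    show "AMap F f \<in> homset D (OMap F A) (OMap F B)" "AMap F g \<in> homset D (OMap F B) (OMap F A)"
      using f g by (auto intro: AMap_in_homset)
    show "AMap F g \<cdot>\<^bsub>D\<^esub> AMap F f = Ident D (OMap F A)"
      "AMap F f \<cdot>\<^bsub>D\<^esub> AMap F g = Ident D (OMap F B)"
      using AMap_Comp[OF f g] AMap_Comp[OF g f] id AMap_Ident source.homsetD(4,5)[OF f] by auto
  qed
qed

end


section \<open>Abelian categories\<close>

context preadditive_category
begin

lemma monoid_hom_group: "\<lbrakk>A \<in> Obj C; B \<in> Obj C\<rbrakk> \<Longrightarrow> monoid (hom_group C A B)"
  by (intro group.is_monoid comm_group.axioms(2) comm_group_hom_group)

lemma Zero_in_homset: "\<lbrakk>A \<in> Obj C; B \<in> Obj C\<rbrakk> \<Longrightarrow> Zero C A B \<in> homset C A B"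
  using monoid.one_closed[OF monoid_hom_group]
  by (simp add: hom_group_def)

lemma Plus_in_homset: "\<lbrakk>f \<in> homset C A B; g \<in> homset C A B\<rbrakk> \<Longrightarrow> Plus C f g \<in> homset C A B"
  using monoid.m_closed[OF monoid_hom_group[of A B], of f g] homsetD(4,5)[of f A B]
  by (simp add: hom_group_def)

text \<open>Cancellation in the hom group. Applied to
  \<open>g \<cdot> 0 = g \<cdot> (0 + 0)\<close>, it shows that composites with zero arrows are
  zero.\<close>

lemma Plus_idem_Zero:
  assumes "f \<in> homset C A B" "Plus C f f = f"
  shows "f = Zero C A B"
proof -
  interpret G: comm_group "hom_group C A B"
    using assms(1) by (intro comm_group_hom_group) (auto dest: homsetD)
  show ?thesis using G.l_cancel_one[of f f] assms by (simp add: hom_group_def)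
qed

lemma Plus_Zero: "f \<in> homset C A B \<Longrightarrow> Plus C f (Zero C A B) = f"
  using monoid.r_one[OF monoid_hom_group[of A B], of f] homsetD(4,5)[of f A B]
  by (simp add: hom_group_def)

lemma Comp_Zero:
  assumes "g \<in> homset C B D" "A \<in> Obj C"
  shows "g \<cdot> Zero C A B = Zero C A D"
proof -
  have Z: "Zero C A B \<in> homset C A B" using assms Zero_in_homset homsetD(4) by blast
  show ?thesis
    using Plus_idem_Zero[OF Comp_in_homset[OF Z assms(1)]] Comp_Plus_right[OF Z Z assms(1)]
      Plus_Zero[OF Z] by simp
qed

lemma Zero_Comp:
  assumes "f \<in> homset C A B" "D \<in> Obj C"
  shows "Zero C B D \<cdot> f = Zero C A D"
proof -
  have Z: "Zero C B D \<in> homset C B D" using assms Zero_in_homset homsetD(5) by blast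
  show ?thesis
    using Plus_idem_Zero[OF Comp_in_homset[OF assms(1) Z]] Comp_Plus_left[OF assms(1) Z Z]
      Plus_Zero[OF Z] by simp
qed

text \<open>Two arrows that \<open>m\<close> identifies have a difference killed by
  \<open>m\<close>, so a trivial kernel suffices.\<close>

lemma is_monoI:
  assumes m: "m \<in> homset C A B"
    and ker: "\<And>T x. \<lbrakk>x \<in> homset C T A; m \<cdot> x = Zero C T B\<rbrakk> \<Longrightarrow> x = Zero C T A"
  shows "is_mono C m"
  unfolding is_mono_def
proof (intro conjI allI ballI impI)
  show "m \<in> Arr C" using m by (rule homsetD)
  fix T g h
  assume "g \<in> homset C T (Dom C m)" "h \<in> homset C T (Dom C m)" and eq: "m \<cdot> g = m \<cdot> h"
  then have g: "g \<in> homset C T A" and h: "h \<in> homset C T A" using homsetD(2)[OF m] by auto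
  interpret G: comm_group "hom_group C T A"
    using homsetD(4,5)[OF g] by (rule comm_group_hom_group)
  \<comment> \<open>The negative of \<open>h\<close>; the difference of \<open>g\<close> and
    \<open>h\<close> is then \<open>Plus C g h'\<close>.\<close>
  define h' where "h' = inv\<^bsub>hom_group C T A\<^esub> h"
  have h': "h' \<in> homset C T A" using G.inv_closed[of h] h by (simp add: h'_def hom_group_def)
  have Plus_h': "Plus C h h' = Zero C T A"
    using G.r_inv[of h] h by (simp add: h'_def hom_group_def)
  have "m \<cdot> Plus C g h' = m \<cdot> Plus C h h'"
    using Comp_Plus_right[OF _ h' m] g h eq by metis
  also have "\<dots> = Zero C T B" using Comp_Zero[OF m homsetD(4)[OF g]] Plus_h' by simp
  finally have "Plus C g h' = Plus C h h'"
    using ker Plus_in_homset[OF g h'] Plus_h' by simp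
  then show "g = h" using G.right_cancel[of h' g h] g h h' by (simp add: hom_group_def)
qed

lemma is_kernelD:
  assumes "is_kernel C k g" "g \<in> homset C B D"
  shows "k \<in> homset C (Dom C k) B" "g \<cdot> k = Zero C (Dom C k) D"
    "\<lbrakk>h \<in> homset C T B; g \<cdot> h = Zero C T D\<rbrakk> \<Longrightarrow> \<exists>u \<in> homset C T (Dom C k). k \<cdot> u = h"
proof -
  show "k \<in> homset C (Dom C k) B" "g \<cdot> k = Zero C (Dom C k) D"
    using assms by (auto simp: is_kernel_def homset_def)
  assume h: "h \<in> homset C T B" and "g \<cdot> h = Zero C T D"
  then show "\<exists>u \<in> homset C T (Dom C k). k \<cdot> u = h"
    using assms(1) homsetD(4)[OF h] unfolding is_kernel_def homsetD(2,3)[OF assms(2)] by blast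
qed

lemma is_cokernelD:
  assumes "is_cokernel C q f" "f \<in> homset C A B"
  shows "q \<in> homset C B (Cod C q)" "q \<cdot> f = Zero C A (Cod C q)"
    "\<lbrakk>h \<in> homset C B T; h \<cdot> f = Zero C A T\<rbrakk> \<Longrightarrow> \<exists>u \<in> homset C (Cod C q) T. u \<cdot> q = h"
proof -
  show "q \<in> homset C B (Cod C q)" "q \<cdot> f = Zero C A (Cod C q)"
    using assms by (auto simp: is_cokernel_def homset_def)
  assume h: "h \<in> homset C B T" and "h \<cdot> f = Zero C A T"
  then show "\<exists>u \<in> homset C (Cod C q) T. u \<cdot> q = h"
    using assms(1) homsetD(5)[OF h] unfolding is_cokernel_def homsetD(2,3)[OF assms(2)] by blast
qed

text \<open>If \<open>k \<cdot> u = k \<cdot> v\<close>, then \<open>u\<close> and \<open>v\<close>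
  are two factorisations of one arrow killed by \<open>g\<close>, and such factorisations are
  unique.\<close>

lemma kernel_mono:
  assumes "is_kernel C k g"
  shows "is_mono C k"
  unfolding is_mono_def
proof (intro conjI allI ballI impI)
  show "k \<in> Arr C" using assms by (simp add: is_kernel_def)
  have g: "g \<in> homset C (Dom C g) (Cod C g)" using assms Arr_homset by (simp add: is_kernel_def)
  note k = is_kernelD(1,2)[OF assms g]
  fix T u v
  assume u: "u \<in> homset C T (Dom C k)" and v: "v \<in> homset C T (Dom C k)" and eq: "k \<cdot> u = k \<cdot> v"
  have "g \<cdot> (k \<cdot> u) = Zero C T (Cod C g)"
    using Comp_assoc[OF u k(1) g] k(2) Zero_Comp[OF u] homsetD(5)[OF g] by simp
  then have "\<exists>!w. w \<in> homset C T (Dom C k) \<and> k \<cdot> w = k \<cdot> u"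
    using assms Comp_in_homset[OF u k(1)] homsetD(4)[OF u] unfolding is_kernel_def by blast
  then show "u = v" using u v eq by metis
qed

lemma cokernel_epi:
  assumes "is_cokernel C q f"
  shows "is_epi C q"
  unfolding is_epi_def
proof (intro conjI allI ballI impI)
  show "q \<in> Arr C" using assms by (simp add: is_cokernel_def)
  have f: "f \<in> homset C (Dom C f) (Cod C f)" using assms Arr_homset by (simp add: is_cokernel_def)
  note q = is_cokernelD(1,2)[OF assms f]
  fix T u v
  assume u: "u \<in> homset C (Cod C q) T" and v: "v \<in> homset C (Cod C q) T" and eq: "u \<cdot> q = v \<cdot> q"
  have "(u \<cdot> q) \<cdot> f = Zero C (Dom C f) T"
    using Comp_assoc[OF f q(1) u] q(2) Comp_Zero[OF u] homsetD(4)[OF f] by simp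
  then have "\<exists>!w. w \<in> homset C (Cod C q) T \<and> w \<cdot> q = u \<cdot> q"
    using assms Comp_in_homset[OF q(1) u] homsetD(5)[OF u] unfolding is_cokernel_def by blast
  then show "u = v" using u v eq by metis
qed

text \<open>Uniqueness of factorisations comes from \<open>k\<close> being mono, so only their
  existence has to be checked.\<close>

lemma is_kernelI:
  assumes k: "k \<in> homset C A B" and g: "g \<in> homset C B D" and gk: "g \<cdot> k = Zero C A D"
    and mono: "is_mono C k"
    and factor: "\<And>T h. \<lbrakk>h \<in> homset C T B; g \<cdot> h = Zero C T D\<rbrakk> \<Longrightarrow> \<exists>u \<in> homset C T A. k \<cdot> u = h"
  shows "is_kernel C k g"
  unfolding is_kernel_def homsetD(2,3)[OF k] homsetD(2,3)[OF g]
  using factor is_monoD[OF mono k] gk homsetD(1)[OF k] homsetD(1)[OF g] by blast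

lemma is_epiD:
  "\<lbrakk>is_epi C e; e \<in> homset C A B; g \<in> homset C B T; h \<in> homset C B T; g \<cdot> e = h \<cdot> e\<rbrakk> \<Longrightarrow> g = h"
  unfolding is_epi_def by (metis homsetD(3))

lemma epi_Comp:
  assumes "is_epi C e" "e \<in> homset C A B" "is_epi C f" "f \<in> homset C B D"
  shows "is_epi C (f \<cdot> e)"
  unfolding is_epi_def homsetD(3)[OF Comp_in_homset[OF assms(2,4)]]
proof (intro conjI allI ballI impI)
  show "f \<cdot> e \<in> Arr C" using Comp_in_homset[OF assms(2,4)] by (rule homsetD)
  fix T g h
  assume g: "g \<in> homset C D T" and h: "h \<in> homset C D T" and eq: "g \<cdot> (f \<cdot> e) = h \<cdot> (f \<cdot> e)"
  have "(g \<cdot> f) \<cdot> e = (h \<cdot> f) \<cdot> e"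
    using eq Comp_assoc[OF assms(2,4)] g h by simp
  then have "g \<cdot> f = h \<cdot> f"
    using is_epiD[OF assms(1,2)] Comp_in_homset[OF assms(4)] g h by blast
  then show "g = h" using is_epiD[OF assms(3,4) g h] by simp
qed

text \<open>The identity of a terminal \<open>N\<close> must equal its zero endomorphism, so every
  arrow out of \<open>N\<close> is zero. Testing arrows into an object is convenient because right
  adjoints control exactly those.\<close>

lemma terminal_is_zero_obj:
  assumes "N \<in> Obj C" and terminal: "\<And>A. A \<in> Obj C \<Longrightarrow> \<exists>!f. f \<in> homset C A N"
  shows "is_zero_obj C N"
  unfolding is_zero_obj_def
proof (intro conjI ballI assms)
  fix A assume A: "A \<in> Obj C"
  show "\<exists>!f. f \<in> homset C N A"
  proof
    show "Zero C N A \<in> homset C N A" using assms(1) A by (rule Zero_in_homset)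
    fix f assume f: "f \<in> homset C N A"
    have "Ident C N = Zero C N N"
      using terminal[OF assms(1)] Ident_in_homset[OF assms(1)] Zero_in_homset[OF assms(1,1)] by blast
    then show "f = Zero C N A" using Comp_Ident[OF f] Comp_Zero[OF f assms(1)] by simp
  qed
qed

text \<open>Recognises zero arrows without mentioning addition; this is how functors not assumed
  additive are shown to respect them.\<close>

lemma Comp_through_zero_obj:
  assumes N: "is_zero_obj C N" and f: "f \<in> homset C A N" and g: "g \<in> homset C N B"
  shows "g \<cdot> f = Zero C A B"
proof -
  have "f = Zero C A N"
    using zero_objD(2)[OF N homsetD(4)[OF f]] f Zero_in_homset[OF homsetD(4,5)[OF f]] by blast
  then show ?thesis using Comp_Zero[OF g homsetD(4)[OF f]] by simp
qed

end

section \<open>Coimages, and torsion-free classes in left exact sequences\<close>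

context abelian_category
begin

text \<open>If \<open>m \<cdot> x = 0\<close>, let \<open>c\<close> be a cokernel of \<open>x\<close>. The epimorphism \<open>c \<cdot> q\<close> is a cokernel of
  some \<open>w\<close>; as \<open>g\<close> factors through \<open>c \<cdot> q\<close>, the arrow \<open>w\<close> factors through \<open>k\<close>, so \<open>q \<cdot> w = 0\<close>
  and \<open>q\<close> factors through \<open>c \<cdot> q\<close>. Hence \<open>c\<close> is a split monomorphism and \<open>x = 0\<close>.\<close>

lemma mono_of_coimage:
  assumes g: "g \<in> homset C B D" and k: "is_kernel C k g" and q: "is_cokernel C q k"
    and m: "m \<in> homset C (Cod C q) D" and mq: "m \<cdot> q = g"
  shows "is_mono C m"
proof (rule is_monoI[OF m])
  note kD = is_kernelD[OF k g]
  note qD = is_cokernelD[OF q kD(1)]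
  fix T x assume x: "x \<in> homset C T (Cod C q)" and mx: "m \<cdot> x = Zero C T D"
  obtain c where c: "is_cokernel C c x" using cokernel_exists[OF homsetD(1)[OF x]] by blast
  note cD = is_cokernelD[OF c x]
  obtain m' where m': "m' \<in> homset C (Cod C c) D" "m' \<cdot> c = m" using cD(3)[OF m mx] by blast
  have cq: "c \<cdot> q \<in> homset C B (Cod C c)" using qD(1) cD(1) by (rule Comp_in_homset)
  have "is_epi C (c \<cdot> q)" by (rule epi_Comp[OF cokernel_epi[OF q] qD(1) cokernel_epi[OF c] cD(1)])
  then obtain w where w: "is_cokernel C (c \<cdot> q) w" using epi_is_cokernel by blast
  define W where "W = Dom C w"
  have wB: "w \<in> homset C W B"
    using w homsetD(2)[OF cq] by (simp add: is_cokernel_def W_def homset_def)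
  note wD = is_cokernelD(2,3)[OF w wB, unfolded homsetD(3)[OF cq]]
  have "g = m' \<cdot> (c \<cdot> q)" using Comp_assoc[OF qD(1) cD(1) m'(1)] m'(2) mq by simp
  then have "g \<cdot> w = Zero C W D"
    using Comp_assoc[OF wB cq m'(1)] wD(1) Comp_Zero[OF m'(1)] homsetD(4)[OF wB] by simp
  then obtain v where v: "v \<in> homset C W (Dom C k)" "k \<cdot> v = w" using kD(3)[OF wB] by blast
  have "q \<cdot> w = Zero C W (Cod C q)"
    using Comp_assoc[OF v(1) kD(1) qD(1)] v(2) qD(2) Zero_Comp[OF v(1)] homsetD(5)[OF qD(1)] by simp
  then obtain u where u: "u \<in> homset C (Cod C c) (Cod C q)" "u \<cdot> (c \<cdot> q) = q"
    using wD(2)[OF qD(1)] by blast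
  have "(u \<cdot> c) \<cdot> q = Ident C (Cod C q) \<cdot> q"
    using Comp_assoc[OF qD(1) cD(1) u(1)] u(2) Ident_Comp[OF qD(1)] by simp
  then have uc: "u \<cdot> c = Ident C (Cod C q)"
    using is_epiD[OF cokernel_epi[OF q] qD(1) Comp_in_homset[OF cD(1) u(1)]]
      Ident_in_homset[OF homsetD(5)[OF qD(1)]] by blast
  have "x = u \<cdot> (c \<cdot> x)" using Comp_assoc[OF x cD(1) u(1)] uc Ident_Comp[OF x] by simp
  then show "x = Zero C T (Cod C q)"
    using cD(2) Comp_Zero[OF u(1) homsetD(4)[OF x]] by simp
qed

text \<open>Let \<open>q\<close> be a cokernel of \<open>k\<close> and write
  \<open>g = m \<cdot> q\<close>. By \<open>mono_of_coimage\<close>, \<open>m\<close> is mono, so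
  \<open>Cod C q\<close> is a subobject of \<open>Cod C g\<close> and lies in \<open>S\<close>.
  Replacing \<open>g\<close> by \<open>q\<close> gives a short exact sequence, to which closure
  under extensions applies.\<close>

lemma torsion_free_class_left_exact:
  assumes S: "torsion_free_class C S" and k: "is_kernel C k g"
    and "Dom C k \<in> S" "Cod C g \<in> S"
  shows "Cod C k \<in> S"
proof -
  have "k \<in> Arr C" using k by (simp add: is_kernel_def)
  then obtain q where q: "is_cokernel C q k" using cokernel_exists by blast
  have g: "g \<in> homset C (Dom C g) (Cod C g)" using k Arr_homset by (simp add: is_kernel_def)
  note kD = is_kernelD[OF k g]
  note qD = is_cokernelD[OF q kD(1)]
  obtain m where m: "m \<in> homset C (Cod C q) (Cod C g)" "m \<cdot> q = g" using qD(3)[OF g kD(2)] by blast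
  have "is_mono C m" by (rule mono_of_coimage[OF g k q m])
  then have "Cod C q \<in> S"
    using S assms(4) homsetD(2,3)[OF m(1)]
    unfolding torsion_free_class_def closed_under_subobjects_def by metis
  \<comment> \<open>An arrow killed by \<open>q\<close> is also killed by
    \<open>g = m \<cdot> q\<close>, hence factors through \<open>k\<close>.\<close>
  moreover have "is_kernel C k q"
  proof (rule is_kernelI[OF kD(1) qD(1,2) kernel_mono[OF k]])
    fix T h assume h: "h \<in> homset C T (Dom C g)" and qh: "q \<cdot> h = Zero C T (Cod C q)"
    have "g \<cdot> h = Zero C T (Cod C g)"
      using Comp_assoc[OF h qD(1) m(1)] m(2) qh Comp_Zero[OF m(1)] homsetD(4)[OF h] by simp
    then show "\<exists>u \<in> homset C T (Dom C k). k \<cdot> u = h" by (rule kD(3)[OF h])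
  qed
  ultimately show ?thesis
    using S q assms(3) unfolding torsion_free_class_def closed_under_extensions_def short_exact_def
    by blast
qed

end

lemma (in preadditive_category) torsion_free_class_Int:
  assumes "torsion_free_class C S" "torsion_free_class C T"
  shows "torsion_free_class C (S \<inter> T)"
proof -
  obtain N where "N \<in> S" "is_zero_obj C N"
    using assms by (auto simp: torsion_free_class_def subcategory_def)
  moreover have "N \<in> T"
    using subcategory_zero_obj assms(2) \<open>is_zero_obj C N\<close> by (auto simp: torsion_free_class_def)
  ultimately have "subcategory C (S \<inter> T)"
    using assms unfolding torsion_free_class_def subcategory_def by blast
  then show ?thesis
    using assms unfolding torsion_free_class_def closed_under_extensions_def
      closed_under_subobjects_def by blast
qed


section \<open>Adjunctions\<close>

text \<open>Fixes one of the bijections whose existence \<open>adjoint_pair\<close> asserts, so that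
  transposes can be computed with. The object conditions in naturality follow from the
  arrows.\<close>

locale adjunction = L: cfunctor C D L + R: cfunctor D C R
  for C :: "('o, 'm, 'e) category_scheme"
    and D :: "('p, 'n, 'd) category_scheme"
    and L :: "('o, 'm, 'p, 'n) cfunctor"
    and R :: "('p, 'n, 'o, 'm) cfunctor" +
  fixes \<phi> :: "'o \<Rightarrow> 'p \<Rightarrow> 'n \<Rightarrow> 'm"
  assumes bij: "\<lbrakk>A \<in> Obj C; B \<in> Obj D\<rbrakk>
      \<Longrightarrow> bij_betw (\<phi> A B) (homset D (OMap L A) B) (homset C A (OMap R B))"
    and natural: "\<lbrakk>f \<in> homset C A' A; g \<in> homset D B B'; h \<in> homset D (OMap L A) B\<rbrakk>
      \<Longrightarrow> \<phi> A' B' (g \<cdot>\<^bsub>D\<^esub> (h \<cdot>\<^bsub>D\<^esub> AMap L f)) = AMap R g \<cdot>\<^bsub>C\<^esub> (\<phi> A B h \<cdot>\<^bsub>C\<^esub> f)"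
begin

lemma transpose_in_homset:
  "\<lbrakk>A \<in> Obj C; h \<in> homset D (OMap L A) B\<rbrakk> \<Longrightarrow> \<phi> A B h \<in> homset C A (OMap R B)"
  using bij L.target.homsetD(5) bij_betwE by blast

lemma transpose_inj:
  "\<lbrakk>A \<in> Obj C; h \<in> homset D (OMap L A) B; h' \<in> homset D (OMap L A) B; \<phi> A B h = \<phi> A B h'\<rbrakk>
    \<Longrightarrow> h = h'"
  using bij L.target.homsetD(5) bij_betw_imp_inj_on inj_onD by metis

lemma transpose_surj:
  assumes "B \<in> Obj D" "f \<in> homset C A (OMap R B)"
  obtains h where "h \<in> homset D (OMap L A) B" "\<phi> A B h = f"
proof -
  have "f \<in> \<phi> A B ` homset D (OMap L A) B"
    using bij_betw_imp_surj_on[OF bij[OF L.source.homsetD(4)[OF assms(2)] assms(1)]] assms(2) by simp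
  then show ?thesis using that by blast
qed

text \<open>Naturality with the identity of \<open>A\<close> as first arrow;
  \<open>transpose_Comp_AMap\<close> takes the identity of \<open>B\<close> as second arrow
  instead.\<close>

lemma transpose_Comp:
  assumes A: "A \<in> Obj C" and g: "g \<in> homset D B B'" and h: "h \<in> homset D (OMap L A) B"
  shows "\<phi> A B' (g \<cdot>\<^bsub>D\<^esub> h) = AMap R g \<cdot>\<^bsub>C\<^esub> \<phi> A B h"
  using natural[OF L.source.Ident_in_homset[OF A] g h] L.AMap_Ident[OF A] L.target.Comp_Ident[OF h]
    L.source.Comp_Ident[OF transpose_in_homset[OF A h]] by simp

lemma transpose_Comp_AMap:
  assumes f: "f \<in> homset C A' A" and h: "h \<in> homset D (OMap L A) B"
  shows "\<phi> A' B (h \<cdot>\<^bsub>D\<^esub> AMap L f) = \<phi> A B h \<cdot>\<^bsub>C\<^esub> f"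
proof -
  note B = L.target.homsetD(5)[OF h]
  have "h \<cdot>\<^bsub>D\<^esub> AMap L f \<in> homset D (OMap L A') B"
    using L.target.Comp_in_homset[OF L.AMap_in_homset[OF f] h] .
  moreover have "\<phi> A B h \<cdot>\<^bsub>C\<^esub> f \<in> homset C A' (OMap R B)"
    using L.source.Comp_in_homset[OF f transpose_in_homset[OF L.source.homsetD(5)[OF f] h]] .
  ultimately show ?thesis
    using natural[OF f L.target.Ident_in_homset[OF B] h] R.AMap_Ident[OF B]
      L.target.Ident_Comp L.source.Ident_Comp by simp
qed

text \<open>The unit \<open>\<eta>\<close> is inverted by the lift \<open>\<psi>\<close> of the
  counit at \<open>OMap L A\<close> along the full functor \<open>L\<close>. For the recollement
  this identifies the composite of \<open>il_star\<close> and \<open>iu_shriek\<close> with the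
  identity.\<close>

lemma isomorphic_unit:
  assumes ff: "fully_faithful C D L" and A: "A \<in> Obj C"
  shows "isomorphic C A (OMap R (OMap L A))"
proof -
  note LA = L.OMap_in_Obj[OF A]
  note RLA = R.OMap_in_Obj[OF LA]
  note idL = L.target.Ident_in_homset[OF LA]
  define \<eta> where "\<eta> = \<phi> A (OMap L A) (Ident D (OMap L A))"
  have \<eta>: "\<eta> \<in> homset C A (OMap R (OMap L A))"
    unfolding \<eta>_def by (rule transpose_in_homset[OF A idL])
  \<comment> \<open>The counit at \<open>OMap L A\<close>, characterised by having an identity as
    its transpose.\<close>
  obtain \<epsilon> where \<epsilon>: "\<epsilon> \<in> homset D (OMap L (OMap R (OMap L A))) (OMap L A)"
    "\<phi> (OMap R (OMap L A)) (OMap L A) \<epsilon> = Ident C (OMap R (OMap L A))"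
    using transpose_surj[OF LA L.source.Ident_in_homset[OF RLA]] .
  obtain \<psi> where \<psi>: "\<psi> \<in> homset C (OMap R (OMap L A)) A" "AMap L \<psi> = \<epsilon>"
    using L.fully_faithful_full[OF ff RLA A \<epsilon>(1)] .
  have \<eta>\<psi>: "\<eta> \<cdot>\<^bsub>C\<^esub> \<psi> = Ident C (OMap R (OMap L A))"
    using transpose_Comp_AMap[OF \<psi>(1) idL] \<psi>(2) L.target.Ident_Comp[OF \<epsilon>(1)] \<epsilon>(2)
    by (simp add: \<eta>_def)
  note L\<eta> = L.AMap_in_homset[OF \<eta>]
  \<comment> \<open>Triangle identity: both sides are equal to \<open>\<eta>\<close>.\<close>
  have "\<phi> A (OMap L A) (\<epsilon> \<cdot>\<^bsub>D\<^esub> AMap L \<eta>) = \<phi> A (OMap L A) (Ident D (OMap L A))"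
    using transpose_Comp_AMap[OF \<eta> \<epsilon>(1)] \<epsilon>(2) L.source.Ident_Comp[OF \<eta>] by (simp add: \<eta>_def)
  then have "\<epsilon> \<cdot>\<^bsub>D\<^esub> AMap L \<eta> = Ident D (OMap L A)"
    using transpose_inj[OF A L.target.Comp_in_homset[OF L\<eta> \<epsilon>(1)] idL] by simp
  then have "AMap L (\<psi> \<cdot>\<^bsub>C\<^esub> \<eta>) = AMap L (Ident C A)"
    using L.AMap_Comp[OF \<eta> \<psi>(1)] \<psi>(2) L.AMap_Ident[OF A] by simp
  then have "\<psi> \<cdot>\<^bsub>C\<^esub> \<eta> = Ident C A"
    by (rule L.fully_faithful_faithful[OF ff L.source.Comp_in_homset[OF \<eta> \<psi>(1)]
          L.source.Ident_in_homset[OF A]])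
  then show ?thesis using L.source.isomorphicI[OF \<eta> \<psi>(1)] \<eta>\<psi> by blast
qed

text \<open>Mirror image of \<open>isomorphic_unit\<close>: fullness of \<open>R\<close> lifts the
  unit at \<open>OMap R B\<close> to an inverse of the counit. It will be applied to
  \<open>ju_star\<close> and \<open>jl_star\<close>.\<close>

lemma isomorphic_counit:
  assumes ff: "fully_faithful D C R" and B: "B \<in> Obj D"
  shows "isomorphic D (OMap L (OMap R B)) B"
proof -
  note RB = R.OMap_in_Obj[OF B]
  note LRB = L.OMap_in_Obj[OF RB]
  note idL = L.target.Ident_in_homset[OF LRB]
  obtain \<epsilon> where \<epsilon>: "\<epsilon> \<in> homset D (OMap L (OMap R B)) B"
    "\<phi> (OMap R B) B \<epsilon> = Ident C (OMap R B)"
    using transpose_surj[OF B L.source.Ident_in_homset[OF RB]] .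
  define \<eta> where "\<eta> = \<phi> (OMap R B) (OMap L (OMap R B)) (Ident D (OMap L (OMap R B)))"
  have \<eta>: "\<eta> \<in> homset C (OMap R B) (OMap R (OMap L (OMap R B)))"
    unfolding \<eta>_def by (rule transpose_in_homset[OF RB idL])
  obtain \<psi> where \<psi>: "\<psi> \<in> homset D B (OMap L (OMap R B))" "AMap R \<psi> = \<eta>"
    using R.fully_faithful_full[OF ff B LRB \<eta>] .
  have "\<phi> (OMap R B) (OMap L (OMap R B)) (\<psi> \<cdot>\<^bsub>D\<^esub> \<epsilon>) = \<eta>"
    using transpose_Comp[OF RB \<psi>(1) \<epsilon>(1)] \<epsilon>(2) \<psi>(2) L.source.Comp_Ident[OF \<eta>] by simp
  then have \<psi>\<epsilon>: "\<psi> \<cdot>\<^bsub>D\<^esub> \<epsilon> = Ident D (OMap L (OMap R B))"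
    using transpose_inj[OF RB L.target.Comp_in_homset[OF \<epsilon>(1) \<psi>(1)] idL] by (simp add: \<eta>_def)
  \<comment> \<open>The other triangle identity: \<open>AMap R \<epsilon>\<close> after
    \<open>\<eta>\<close> is the transpose of \<open>\<epsilon>\<close>, an identity.\<close>
  have "AMap R (\<epsilon> \<cdot>\<^bsub>D\<^esub> \<psi>) = AMap R (Ident D B)"
    using R.AMap_Comp[OF \<psi>(1) \<epsilon>(1)] \<psi>(2) transpose_Comp[OF RB \<epsilon>(1) idL]
      L.target.Comp_Ident[OF \<epsilon>(1)] \<epsilon>(2) R.AMap_Ident[OF B] by (simp add: \<eta>_def)
  then have "\<epsilon> \<cdot>\<^bsub>D\<^esub> \<psi> = Ident D B"
    by (rule R.fully_faithful_faithful[OF ff L.target.Comp_in_homset[OF \<psi>(1) \<epsilon>(1)]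
          L.target.Ident_in_homset[OF B]])
  then show ?thesis using L.target.isomorphicI[OF \<epsilon>(1) \<psi>(1) \<psi>\<epsilon>] by blast
qed

text \<open>Arrows identified by \<open>AMap R m\<close> are transposes of arrows identified by
  \<open>m\<close>.\<close>

lemma right_adjoint_mono:
  assumes "is_mono D m"
  shows "is_mono C (AMap R m)"
proof -
  have "m \<in> Arr D" using assms by (simp add: is_mono_def)
  then have m: "m \<in> homset D (Dom D m) (Cod D m)" by (rule L.target.Arr_homset)
  note Rm = R.AMap_in_homset[OF m]
  show ?thesis
    unfolding is_mono_def L.source.homsetD(2)[OF Rm]
  proof (intro conjI allI ballI impI)
    show "AMap R m \<in> Arr C" using Rm by (rule L.source.homsetD)
    fix T f g
    assume f: "f \<in> homset C T (OMap R (Dom D m))" and g: "g \<in> homset C T (OMap R (Dom D m))"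
      and eq: "AMap R m \<cdot>\<^bsub>C\<^esub> f = AMap R m \<cdot>\<^bsub>C\<^esub> g"
    note T = L.source.homsetD(4)[OF f]
    note dom = L.target.homsetD(4)[OF m]
    obtain f' where f': "f' \<in> homset D (OMap L T) (Dom D m)" "\<phi> T (Dom D m) f' = f"
      using transpose_surj[OF dom f] .
    obtain g' where g': "g' \<in> homset D (OMap L T) (Dom D m)" "\<phi> T (Dom D m) g' = g"
      using transpose_surj[OF dom g] .
    have "m \<cdot>\<^bsub>D\<^esub> f' = m \<cdot>\<^bsub>D\<^esub> g'"
      using transpose_inj[OF T L.target.Comp_in_homset[OF f'(1) m] L.target.Comp_in_homset[OF g'(1) m]]
        transpose_Comp[OF T m] f' g' eq by simp
    then have "f' = g'" using L.target.is_monoD[OF assms m] f' g' by simp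
    then show "f = g" using f' g' by simp
  qed
qed

end

lemma adjoint_pair_adjunction:
  assumes "cfunctor C D L" "cfunctor D C R" "adjoint_pair C D L R"
  obtains \<phi> where "adjunction C D L R \<phi>"
proof -
  interpret L: cfunctor C D L by fact
  obtain \<phi> where bij: "\<And>A B. \<lbrakk>A \<in> Obj C; B \<in> Obj D\<rbrakk>
      \<Longrightarrow> bij_betw (\<phi> A B) (homset D (OMap L A) B) (homset C A (OMap R B))"
    and nat: "\<And>A A' B B' f g h. \<lbrakk>A \<in> Obj C; A' \<in> Obj C; B \<in> Obj D; B' \<in> Obj D;
        f \<in> homset C A' A; g \<in> homset D B B'; h \<in> homset D (OMap L A) B\<rbrakk>
      \<Longrightarrow> \<phi> A' B' (g \<cdot>\<^bsub>D\<^esub> (h \<cdot>\<^bsub>D\<^esub> AMap L f)) = AMap R g \<cdot>\<^bsub>C\<^esub> (\<phi> A B h \<cdot>\<^bsub>C\<^esub> f)"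
    using assms(3) unfolding adjoint_pair_def by blast
  have "adjunction C D L R \<phi>"
  proof (intro adjunction.intro assms(1,2) adjunction_axioms.intro bij)
    fix f A' A g B B' h
    assume *: "f \<in> homset C A' A" "g \<in> homset D B B'" "h \<in> homset D (OMap L A) B"
    show "\<phi> A' B' (g \<cdot>\<^bsub>D\<^esub> (h \<cdot>\<^bsub>D\<^esub> AMap L f)) = AMap R g \<cdot>\<^bsub>C\<^esub> (\<phi> A B h \<cdot>\<^bsub>C\<^esub> f)"
      using nat[OF _ _ _ _ *] L.source.homsetD(4,5)[OF *(1)] L.target.homsetD(4,5)[OF *(2)] by blast
  qed
  then show ?thesis by (rule that)
qed

section \<open>Left exactness of right adjoints between abelian categories\<close>

locale abelian_adjunction = C: abelian_category C + D: abelian_category D + adjunction C D L R \<phi>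
  for C :: "('o, 'm, 'e) preadditive_category_scheme"
    and D :: "('p, 'n, 'd) preadditive_category_scheme"
    and L :: "('o, 'm, 'p, 'n) cfunctor"
    and R :: "('p, 'n, 'o, 'm) cfunctor"
    and \<phi> :: "'o \<Rightarrow> 'p \<Rightarrow> 'n \<Rightarrow> 'm"
begin

lemma right_adjoint_zero_obj:
  assumes N: "is_zero_obj D N"
  shows "is_zero_obj C (OMap R N)"
proof (rule C.terminal_is_zero_obj)
  have N_Obj: "N \<in> Obj D" using N by (simp add: is_zero_obj_def)
  then show "OMap R N \<in> Obj C" by (rule R.OMap_in_Obj)
  fix A assume A: "A \<in> Obj C"
  have "\<exists>!h. h \<in> homset D (OMap L A) N" using N L.OMap_in_Obj[OF A] by (simp add: is_zero_obj_def)
  then show "\<exists>!f. f \<in> homset C A (OMap R N)"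
    by (rule bij_betw_ex1[OF bij[OF A N_Obj]])
qed

text \<open>The bijection is not assumed additive. Factor the zero arrow through a zero object
  \<open>N\<close>; by naturality its transpose factors through \<open>OMap R N\<close>, again a
  zero object.\<close>

lemma transpose_Zero:
  assumes A: "A \<in> Obj C" and B: "B \<in> Obj D"
  shows "\<phi> A B (Zero D (OMap L A) B) = Zero C A (OMap R B)"
proof -
  obtain N where N: "is_zero_obj D N" using D.zero_obj_exists by blast
  then have "N \<in> Obj D" by (simp add: is_zero_obj_def)
  then have h: "Zero D (OMap L A) N \<in> homset D (OMap L A) N" and g: "Zero D N B \<in> homset D N B"
    using D.Zero_in_homset L.OMap_in_Obj[OF A] B by auto
  show ?thesis
    using transpose_Comp[OF A g h] D.Comp_Zero[OF g L.OMap_in_Obj[OF A]]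
      C.Comp_through_zero_obj[OF right_adjoint_zero_obj[OF N] transpose_in_homset[OF A h]
        R.AMap_in_homset[OF g]] by simp
qed

lemma right_adjoint_Zero:
  assumes A: "A \<in> Obj D" and B: "B \<in> Obj D"
  shows "AMap R (Zero D A B) = Zero C (OMap R A) (OMap R B)"
proof -
  obtain N where N: "is_zero_obj D N" using D.zero_obj_exists by blast
  then have "N \<in> Obj D" by (simp add: is_zero_obj_def)
  then have h: "Zero D A N \<in> homset D A N" and g: "Zero D N B \<in> homset D N B"
    using D.Zero_in_homset A B by auto
  show ?thesis
    using R.AMap_Comp[OF h g] D.Comp_Zero[OF g A]
      C.Comp_through_zero_obj[OF right_adjoint_zero_obj[OF N] R.AMap_in_homset[OF h]
        R.AMap_in_homset[OF g]] by simp
qed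

text \<open>An arrow killed by \<open>AMap R g\<close> is the transpose of one killed by
  \<open>g\<close>. That one factors through \<open>k\<close>, and transposing the factorisation
  back gives the one required.\<close>

lemma right_adjoint_kernel:
  assumes k: "is_kernel D k g"
  shows "is_kernel C (AMap R k) (AMap R g)"
proof -
  have g: "g \<in> homset D (Dom D g) (Cod D g)" using k D.Arr_homset by (simp add: is_kernel_def)
  note kD = D.is_kernelD[OF k g]
  note Rg = R.AMap_in_homset[OF g] and Rk = R.AMap_in_homset[OF kD(1)]
  show ?thesis
  proof (rule C.is_kernelI[OF Rk Rg _ right_adjoint_mono[OF D.kernel_mono[OF k]]])
    show "AMap R g \<cdot>\<^bsub>C\<^esub> AMap R k = Zero C (OMap R (Dom D k)) (OMap R (Cod D g))"
      using R.AMap_Comp[OF kD(1) g] kD(2) right_adjoint_Zero D.homsetD(4)[OF kD(1)] D.homsetD(5)[OF g]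
      by simp
    fix T h
    assume h: "h \<in> homset C T (OMap R (Dom D g))"
      and gh: "AMap R g \<cdot>\<^bsub>C\<^esub> h = Zero C T (OMap R (Cod D g))"
    note T = C.homsetD(4)[OF h]
    obtain h' where h': "h' \<in> homset D (OMap L T) (Dom D g)" "\<phi> T (Dom D g) h' = h"
      using transpose_surj[OF D.homsetD(4)[OF g] h] .
    have "\<phi> T (Cod D g) (g \<cdot>\<^bsub>D\<^esub> h') = \<phi> T (Cod D g) (Zero D (OMap L T) (Cod D g))"
      using transpose_Comp[OF T g h'(1)] h'(2) gh transpose_Zero[OF T D.homsetD(5)[OF g]] by simp
    then have "g \<cdot>\<^bsub>D\<^esub> h' = Zero D (OMap L T) (Cod D g)"
      using transpose_inj[OF T D.Comp_in_homset[OF h'(1) g]]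
        D.Zero_in_homset[OF L.OMap_in_Obj[OF T] D.homsetD(5)[OF g]] by blast
    then obtain u where u: "u \<in> homset D (OMap L T) (Dom D k)" "k \<cdot>\<^bsub>D\<^esub> u = h'"
      using kD(3)[OF h'(1)] by blast
    show "\<exists>u \<in> homset C T (OMap R (Dom D k)). AMap R k \<cdot>\<^bsub>C\<^esub> u = h"
      using transpose_in_homset[OF T u(1)] transpose_Comp[OF T kD(1) u(1)] u(2) h'(2) by auto
  qed
qed

text \<open>\<open>R\<close> preserves zero objects, isomorphisms, monos and kernels. It may send a
  short exact sequence to one that is only left exact, which is why extensions are handled by
  \<open>torsion_free_class_left_exact\<close>.\<close>

lemma torsion_free_class_vimage:
  assumes S: "torsion_free_class C S"
  shows "torsion_free_class D {B \<in> Obj D. OMap R B \<in> S}"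
proof -
  have sub: "subcategory C S" using S by (simp add: torsion_free_class_def)
  obtain N where N: "is_zero_obj D N" using D.zero_obj_exists by blast
  have "N \<in> Obj D" "OMap R N \<in> S"
    using N C.subcategory_zero_obj[OF sub right_adjoint_zero_obj[OF N]]
    by (auto simp: is_zero_obj_def)
  then have "subcategory D {B \<in> Obj D. OMap R B \<in> S}"
    using N C.subcategory_isomorphic_iff[OF sub R.isomorphic_OMap]
    unfolding subcategory_def by blast
  moreover have "closed_under_subobjects D {B \<in> Obj D. OMap R B \<in> S}"
    unfolding closed_under_subobjects_def
  proof (intro allI impI)
    fix m assume *: "is_mono D m \<and> Cod D m \<in> {B \<in> Obj D. OMap R B \<in> S}"
    then have m: "m \<in> homset D (Dom D m) (Cod D m)" using D.Arr_homset by (simp add: is_mono_def)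
    note Rm = R.AMap_in_homset[OF m]
    have "OMap R (Dom D m) \<in> S"
      using * S right_adjoint_mono[of m] C.homsetD(2,3)[OF Rm]
      unfolding torsion_free_class_def closed_under_subobjects_def by auto
    then show "Dom D m \<in> {B \<in> Obj D. OMap R B \<in> S}" using D.homsetD(4)[OF m] by simp
  qed
  moreover have "closed_under_extensions D {B \<in> Obj D. OMap R B \<in> S}"
    unfolding closed_under_extensions_def
  proof (intro allI impI)
    fix k g
    assume *: "short_exact D k g \<and> Dom D k \<in> {B \<in> Obj D. OMap R B \<in> S}
      \<and> Cod D g \<in> {B \<in> Obj D. OMap R B \<in> S}"
    then have ker: "is_kernel D k g" by (simp add: short_exact_def)
    then have k: "k \<in> homset D (Dom D k) (Cod D k)" and g: "g \<in> homset D (Dom D g) (Cod D g)"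
      by (auto simp: is_kernel_def homset_def)
    note Rk = R.AMap_in_homset[OF k] and Rg = R.AMap_in_homset[OF g]
    have "OMap R (Cod D k) \<in> S"
      using C.torsion_free_class_left_exact[OF S right_adjoint_kernel[OF ker]] *
        C.homsetD(2,3)[OF Rk] C.homsetD(3)[OF Rg] by simp
    then show "Cod D k \<in> {B \<in> Obj D. OMap R B \<in> S}" using D.homsetD(5)[OF k] by simp
  qed
  ultimately show ?thesis by (simp add: torsion_free_class_def)
qed

end


section \<open>Recollements\<close>

context recollement
begin

lemma ju_star_il_star_zero:
  assumes B: "B \<in> Obj Y"
  shows "is_zero_obj Z (OMap ju_star (OMap il_star B))"
proof -
  have "OMap il_star B \<in> essential_image Y X il_star"
    using B il_star.OMap_in_Obj[OF B] X.isomorphic_refl by (auto simp: essential_image_def)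
  then show ?thesis using essential_image_eq_kernel by (simp add: functor_kernel_def)
qed

text \<open>Two adjunctions turn arrows from \<open>B\<close> into this object into arrows from
  \<open>OMap ju_star (OMap il_star B)\<close> to \<open>A\<close>. The latter source is a zero
  object, so there is exactly one, and the object is terminal.\<close>

lemma iu_shriek_jl_star_zero:
  assumes A: "A \<in> Obj Z"
  shows "is_zero_obj Y (OMap iu_shriek (OMap jl_star A))"
proof (rule Y.terminal_is_zero_obj)
  note jA = jl_star.OMap_in_Obj[OF A]
  show "OMap iu_shriek (OMap jl_star A) \<in> Obj Y" by (rule iu_shriek.OMap_in_Obj[OF jA])
  fix B assume B: "B \<in> Obj Y"
  note iB = il_star.OMap_in_Obj[OF B]
  obtain \<phi> where "adjunction Y X il_star iu_shriek \<phi>"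
    using adjoint_pair_adjunction[OF il_star.cfunctor_axioms iu_shriek.cfunctor_axioms
        adjoint_il_star_iu_shriek] .
  then interpret i: adjunction Y X il_star iu_shriek \<phi> .
  obtain \<psi> where "adjunction X Z ju_star jl_star \<psi>"
    using adjoint_pair_adjunction[OF ju_star.cfunctor_axioms jl_star.cfunctor_axioms
        adjoint_ju_star_jl_star] .
  then interpret j: adjunction X Z ju_star jl_star \<psi> .
  have "\<exists>!f. f \<in> homset Z (OMap ju_star (OMap il_star B)) A"
    using ju_star_il_star_zero[OF B] A by (simp add: is_zero_obj_def)
  then have "\<exists>!f. f \<in> homset X (OMap il_star B) (OMap jl_star A)"
    by (rule bij_betw_ex1[OF j.bij[OF iB A]])
  then show "\<exists>!f. f \<in> homset Y B (OMap iu_shriek (OMap jl_star A))"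
    by (rule bij_betw_ex1[OF i.bij[OF B jA]])
qed

lemma torsion_free_class_iff:
  assumes F\<^sub>Y: "subcategory Y F\<^sub>Y" and F\<^sub>Z: "subcategory Z F\<^sub>Z"
    and F\<^sub>X: "F\<^sub>X = {A \<in> Obj X. OMap ju_star A \<in> F\<^sub>Z \<and> OMap iu_shriek A \<in> F\<^sub>Y}"
  shows "torsion_free_class Y F\<^sub>Y \<and> torsion_free_class Z F\<^sub>Z \<longleftrightarrow> torsion_free_class X F\<^sub>X"
proof -
  \<comment> \<open>The four interpretations present \<open>il_star\<close>,
    \<open>iu_shriek\<close>, \<open>ju_star\<close> and \<open>jl_star\<close>, in this order, as
    right adjoints, so that \<open>torsion_free_class_vimage\<close> applies to each.\<close>
  obtain \<phi>1 where "adjunction X Y iu_star il_star \<phi>1"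
    using adjoint_pair_adjunction[OF iu_star.cfunctor_axioms il_star.cfunctor_axioms
        adjoint_iu_star_il_star] .
  then interpret a1: abelian_adjunction X Y iu_star il_star \<phi>1
    using X.abelian_category_axioms Y.abelian_category_axioms abelian_adjunction.intro by blast
  obtain \<phi>2 where "adjunction Y X il_star iu_shriek \<phi>2"
    using adjoint_pair_adjunction[OF il_star.cfunctor_axioms iu_shriek.cfunctor_axioms
        adjoint_il_star_iu_shriek] .
  then interpret a2: abelian_adjunction Y X il_star iu_shriek \<phi>2
    using X.abelian_category_axioms Y.abelian_category_axioms abelian_adjunction.intro by blast
  obtain \<phi>3 where "adjunction Z X jl_shriek ju_star \<phi>3"
    using adjoint_pair_adjunction[OF jl_shriek.cfunctor_axioms ju_star.cfunctor_axioms
        adjoint_jl_shriek_ju_star] .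
  then interpret a3: abelian_adjunction Z X jl_shriek ju_star \<phi>3
    using X.abelian_category_axioms Z.abelian_category_axioms abelian_adjunction.intro by blast
  obtain \<phi>4 where "adjunction X Z ju_star jl_star \<phi>4"
    using adjoint_pair_adjunction[OF ju_star.cfunctor_axioms jl_star.cfunctor_axioms
        adjoint_ju_star_jl_star] .
  then interpret a4: abelian_adjunction X Z ju_star jl_star \<phi>4
    using X.abelian_category_axioms Z.abelian_category_axioms abelian_adjunction.intro by blast
  \<comment> \<open>The condition over \<open>Z\<close> holds automatically, since zero objects lie
    in \<open>F\<^sub>Z\<close>; the condition over \<open>Y\<close> becomes
    \<open>B \<in> F\<^sub>Y\<close> through the unit isomorphism.\<close>
  have "OMap il_star B \<in> F\<^sub>X \<longleftrightarrow> B \<in> F\<^sub>Y" if B: "B \<in> Obj Y" for B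
    using Y.subcategory_isomorphic_iff[OF F\<^sub>Y a2.isomorphic_unit[OF fully_faithful_il_star B]]
      Z.subcategory_zero_obj[OF F\<^sub>Z ju_star_il_star_zero[OF B]] il_star.OMap_in_Obj[OF B]
    by (simp add: F\<^sub>X)
  then have F\<^sub>Y_eq: "F\<^sub>Y = {B \<in> Obj Y. OMap il_star B \<in> F\<^sub>X}"
    using F\<^sub>Y by (auto simp: subcategory_def)
  \<comment> \<open>Here the condition over \<open>Y\<close> is automatic, and the counit
    isomorphism turns the one over \<open>Z\<close> into \<open>A \<in> F\<^sub>Z\<close>.\<close>
  have "OMap jl_star A \<in> F\<^sub>X \<longleftrightarrow> A \<in> F\<^sub>Z" if A: "A \<in> Obj Z" for A
    using Z.subcategory_isomorphic_iff[OF F\<^sub>Z a4.isomorphic_counit[OF fully_faithful_jl_star A]]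
      Y.subcategory_zero_obj[OF F\<^sub>Y iu_shriek_jl_star_zero[OF A]] jl_star.OMap_in_Obj[OF A]
    by (simp add: F\<^sub>X)
  then have F\<^sub>Z_eq: "F\<^sub>Z = {A \<in> Obj Z. OMap jl_star A \<in> F\<^sub>X}"
    using F\<^sub>Z by (auto simp: subcategory_def)
  have F\<^sub>X_eq: "F\<^sub>X = {A \<in> Obj X. OMap ju_star A \<in> F\<^sub>Z} \<inter> {A \<in> Obj X. OMap iu_shriek A \<in> F\<^sub>Y}"
    by (auto simp: F\<^sub>X)
  show ?thesis
  proof
    assume "torsion_free_class Y F\<^sub>Y \<and> torsion_free_class Z F\<^sub>Z"
    then show "torsion_free_class X F\<^sub>X"
      unfolding F\<^sub>X_eq
      by (intro X.torsion_free_class_Int a2.torsion_free_class_vimage a3.torsion_free_class_vimage)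
        auto
  next
    assume "torsion_free_class X F\<^sub>X"
    then show "torsion_free_class Y F\<^sub>Y \<and> torsion_free_class Z F\<^sub>Z"
      using a1.torsion_free_class_vimage a4.torsion_free_class_vimage F\<^sub>Y_eq F\<^sub>Z_eq by metis
  qed
qed

end

theorem theorem3p4:
  fixes X :: "('xo, 'xm) preadditive_category"
    and Y :: "('yo, 'ym) preadditive_category"
    and Z :: "('zo, 'zm) preadditive_category"
    and F\<^sub>Y :: "'yo set" and F\<^sub>Z :: "'zo set" and F\<^sub>X :: "'xo set"
  assumes "length_abelian_category X"
    and "length_abelian_category Y"
    and "length_abelian_category Z"
    and "recollement Y X Z iu_star il_star iu_shriek jl_shriek ju_star jl_star"
    and "subcategory Y F\<^sub>Y"
    and "subcategory Z F\<^sub>Z"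
    and "F\<^sub>X = {A \<in> Obj X. OMap ju_star A \<in> F\<^sub>Z \<and> OMap iu_shriek A \<in> F\<^sub>Y}"
  shows "torsion_free_class Y F\<^sub>Y \<and> torsion_free_class Z F\<^sub>Z \<longleftrightarrow> torsion_free_class X F\<^sub>X"
  using recollement.torsion_free_class_iff[OF assms(4-7)] .

end
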